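(* Let $k\geq 1$ be an integer, let $n$ be an integer with $n\geq k^{3}/2+k+4$, and let $G$ be a graph of order $n$ with minimum degree $\delta(G)\geq k$. (i) If $G$ is a subgraph of $M_{k}(n)$, then $\lambda(G)<n-k-1$, unless $G=M_{k}(n)$. (ii) If $G$ is a subgraph of $L_{k}(n)$, then $\lambda(G)<n-k-1$, unless $G=L_{k}(n)$.
   Context: Graphs are finite, simple and undirected. $\lambda(G)$ denotes the spectral radius (largest eigenvalue) of the adjacency matrix of $G$, and $\delta(G)$ its minimum degree. $K_s$ and $\overline{K}_s$ denote the complete graph and the edgeless graph of order $s$; $G\vee H$ denotes the join and $G+H$ the disjoint union of graphs $G$ and $H$. For $k\geq 1$ and $n\geq 2k+1$, \[ L_k(n):=K_1\vee (K_{n-k-1}+K_k),\qquad M_k(n):=K_k\vee (K_{n-2k}+\overline{K}_k). \] Both graphs have order $n$. *)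

theory Defs
  imports "Graph_Theory.Graph_Theory" "Jordan_Normal_Form.Spectral_Radius"
begin

text \<open>Finite simple undirected graphs are the locale \<open>pair_graph\<close>: finite, symmetric, loop-free,
  each undirected edge \<open>uv\<close> being represented by the two arcs \<open>(u,v)\<close> and \<open>(v,u)\<close>.\<close>

definition complete_graph :: "nat \<Rightarrow> nat pair_pre_digraph" where
  "complete_graph s = \<lparr> pverts = {..<s}, parcs = {(u, v). u < s \<and> v < s \<and> u \<noteq> v} \<rparr>"

definition edgeless_graph :: "nat \<Rightarrow> nat pair_pre_digraph" where
  "edgeless_graph s = \<lparr> pverts = {..<s}, parcs = {} \<rparr>"

definition disjoint_union ::
  "'a pair_pre_digraph \<Rightarrow> 'b pair_pre_digraph \<Rightarrow> ('a + 'b) pair_pre_digraph" where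
  "disjoint_union G H = \<lparr>
     pverts = pverts G <+> pverts H,
     parcs = map_prod Inl Inl ` parcs G \<union> map_prod Inr Inr ` parcs H \<rparr>"

definition graph_join ::
  "'a pair_pre_digraph \<Rightarrow> 'b pair_pre_digraph \<Rightarrow> ('a + 'b) pair_pre_digraph" where
  "graph_join G H = \<lparr>
     pverts = pverts G <+> pverts H,
     parcs = map_prod Inl Inl ` parcs G \<union> map_prod Inr Inr ` parcs H
       \<union> (Inl ` pverts G) \<times> (Inr ` pverts H) \<union> (Inr ` pverts H) \<times> (Inl ` pverts G) \<rparr>"

definition L_graph :: "nat \<Rightarrow> nat \<Rightarrow> (nat + (nat + nat)) pair_pre_digraph" where
  "L_graph k n =
     graph_join (complete_graph 1) (disjoint_union (complete_graph (n - k - 1)) (complete_graph k))"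

definition M_graph :: "nat \<Rightarrow> nat \<Rightarrow> (nat + (nat + nat)) pair_pre_digraph" where
  "M_graph k n =
     graph_join (complete_graph k) (disjoint_union (complete_graph (n - 2 * k)) (edgeless_graph k))"

text \<open>\<open>G\<close> is a subgraph of \<open>H\<close> in the usual sense for unlabelled graphs: \<open>G\<close> is isomorphic to a
  subgraph of \<open>H\<close>.\<close>

definition subgraph_upto_iso :: "('a, 'b) pre_digraph \<Rightarrow> ('c, 'd) pre_digraph \<Rightarrow> bool" where
  "subgraph_upto_iso G H \<longleftrightarrow> (\<exists>H'. subgraph H' H \<and> digraph_iso G H')"

text \<open>By symmetry the number of arcs leaving a vertex is its number of neighbours.\<close>

definition min_degree :: "'a pair_pre_digraph \<Rightarrow> nat" where
  "min_degree G = Min (out_degree G ` pverts G)"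

definition adjacency_mat :: "'a list \<Rightarrow> 'a pair_pre_digraph \<Rightarrow> real mat" where
  "adjacency_mat xs G = Matrix.mat (length xs) (length xs)
     (\<lambda>(i, j). if (xs ! i, xs ! j) \<in> parcs G then 1 else 0)"

text \<open>The largest eigenvalue of the (real symmetric) adjacency matrix, for some enumeration of the
  vertices; \<open>graph_spectral_radius_eq\<close> shows that the enumeration is irrelevant, and
  \<open>adjacency_spectrum_nonempty\<close> that the maximum exists.\<close>

definition graph_spectral_radius :: "'a pair_pre_digraph \<Rightarrow> real" where
  "graph_spectral_radius G =
     Max (spectrum (adjacency_mat (SOME xs. distinct xs \<and> set xs = pverts G) G))"

lemma pair_graphI_explicit:
  assumes "finite (pverts G)" "parcs G \<subseteq> pverts G \<times> pverts G" "sym (parcs G)" "irrefl (parcs G)"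
  shows "pair_graph G"
proof
  show "finite (parcs G)" using assms finite_subset by blast
  show "symmetric (with_proj G)" using assms by (simp add: symmetric_def)
qed (use assms in \<open>auto simp: irrefl_def\<close>)

lemma pair_graph_explicit:
  assumes "pair_graph G"
  shows "finite (pverts G)" "parcs G \<subseteq> pverts G \<times> pverts G" "sym (parcs G)" "irrefl (parcs G)"
proof -
  interpret pair_graph G by fact
  show "finite (pverts G)" by (rule pair_finite_verts)
  show "parcs G \<subseteq> pverts G \<times> pverts G" by (auto dest: in_arcsD1 in_arcsD2)
  show "sym (parcs G)" using pair_sym_arcs by (simp add: symmetric_def)
  show "irrefl (parcs G)" using pair_no_loops by (fastforce simp: irrefl_def)
qed

lemma pair_graph_complete_graph: "pair_graph (complete_graph s)"
  by (rule pair_graphI_explicit) (auto simp: complete_graph_def sym_def irrefl_def)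

lemma complete_graph_is_complete: "complete_digraph s (with_proj (complete_graph s))"
  by (auto simp: complete_digraph_pair_def complete_graph_def)

lemma pair_graph_edgeless_graph: "pair_graph (edgeless_graph s)"
  by (rule pair_graphI_explicit) (auto simp: edgeless_graph_def sym_def irrefl_def)

lemma disjoint_union_simps [simp]:
  "pverts (disjoint_union G H) = pverts G <+> pverts H"
  "(Inl u, Inl v) \<in> parcs (disjoint_union G H) \<longleftrightarrow> (u, v) \<in> parcs G"
  "(Inr x, Inr y) \<in> parcs (disjoint_union G H) \<longleftrightarrow> (x, y) \<in> parcs H"
  "(Inl u, Inr y) \<notin> parcs (disjoint_union G H)"
  "(Inr x, Inl v) \<notin> parcs (disjoint_union G H)"
  by (force simp: disjoint_union_def)+

lemma graph_join_simps [simp]: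
  "pverts (graph_join G H) = pverts G <+> pverts H"
  "(Inl u, Inl v) \<in> parcs (graph_join G H) \<longleftrightarrow> (u, v) \<in> parcs G"
  "(Inr x, Inr y) \<in> parcs (graph_join G H) \<longleftrightarrow> (x, y) \<in> parcs H"
  "(Inl u, Inr y) \<in> parcs (graph_join G H) \<longleftrightarrow> u \<in> pverts G \<and> y \<in> pverts H"
  "(Inr x, Inl v) \<in> parcs (graph_join G H) \<longleftrightarrow> v \<in> pverts G \<and> x \<in> pverts H"
  by (force simp: graph_join_def)+

lemma pair_graph_disjoint_union:
  assumes "pair_graph G" "pair_graph H"
  shows "pair_graph (disjoint_union G H)"
proof (rule pair_graphI_explicit)
  note G = pair_graph_explicit[OF assms(1)] and H = pair_graph_explicit[OF assms(2)]
  show "finite (pverts (disjoint_union G H))" using G(1) H(1) by simp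
  show "parcs (disjoint_union G H) \<subseteq> pverts (disjoint_union G H) \<times> pverts (disjoint_union G H)"
    using G(2) H(2) by (auto simp: disjoint_union_def)
  show "sym (parcs (disjoint_union G H))"
  proof (rule symI)
    fix a b assume "(a, b) \<in> parcs (disjoint_union G H)"
    then show "(b, a) \<in> parcs (disjoint_union G H)"
      by (cases a; cases b) (auto dest: symD[OF G(3)] symD[OF H(3)])
  qed
  show "irrefl (parcs (disjoint_union G H))"
  proof (rule irreflI)
    fix a show "(a, a) \<notin> parcs (disjoint_union G H)"
      using G(4) H(4) by (cases a) (auto simp: irrefl_def)
  qed
qed

lemma pair_graph_graph_join:
  assumes "pair_graph G" "pair_graph H"
  shows "pair_graph (graph_join G H)"
proof (rule pair_graphI_explicit)
  note G = pair_graph_explicit[OF assms(1)] and H = pair_graph_explicit[OF assms(2)]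
  show "finite (pverts (graph_join G H))" using G(1) H(1) by simp
  show "parcs (graph_join G H) \<subseteq> pverts (graph_join G H) \<times> pverts (graph_join G H)"
    using G(2) H(2) by (auto simp: graph_join_def)
  show "sym (parcs (graph_join G H))"
  proof (rule symI)
    fix a b assume "(a, b) \<in> parcs (graph_join G H)"
    then show "(b, a) \<in> parcs (graph_join G H)"
      by (cases a; cases b) (auto dest: symD[OF G(3)] symD[OF H(3)])
  qed
  show "irrefl (parcs (graph_join G H))"
  proof (rule irreflI)
    fix a show "(a, a) \<notin> parcs (graph_join G H)"
      using G(4) H(4) by (cases a) (auto simp: irrefl_def)
  qed
qed

lemma pair_graph_L_graph: "pair_graph (L_graph k n)"
  by (simp add: L_graph_def pair_graph_graph_join pair_graph_disjoint_union
      pair_graph_complete_graph)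

lemma pair_graph_M_graph: "pair_graph (M_graph k n)"
  by (simp add: M_graph_def pair_graph_graph_join pair_graph_disjoint_union
      pair_graph_complete_graph pair_graph_edgeless_graph)

lemma card_L_graph: "2 * k + 1 \<le> n \<Longrightarrow> card (pverts (L_graph k n)) = n"
  by (simp add: L_graph_def graph_join_def disjoint_union_def complete_graph_def card_Plus)

lemma card_M_graph: "2 * k + 1 \<le> n \<Longrightarrow> card (pverts (M_graph k n)) = n"
  by (simp add: M_graph_def graph_join_def disjoint_union_def complete_graph_def
      edgeless_graph_def card_Plus)

lemma adjacency_mat_carrier [simp]: "adjacency_mat xs G \<in> carrier_mat (length xs) (length xs)"
  by (simp add: adjacency_mat_def)

lemma adjacency_mat_mult_index:
  assumes "i < length xs" "v \<in> carrier_vec (length xs)"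
  shows "(adjacency_mat xs G *\<^sub>v v) $ i =
    (\<Sum>j<length xs. (if (xs ! i, xs ! j) \<in> parcs G then v $ j else 0))"
proof -
  have "(adjacency_mat xs G *\<^sub>v v) $ i =
    (\<Sum>j\<in>{0..<length xs}. (if (xs ! i, xs ! j) \<in> parcs G then 1 else 0) * v $ j)"
    using assms by (simp add: adjacency_mat_def scalar_prod_def)
  also have "\<dots> = (\<Sum>j<length xs. (if (xs ! i, xs ! j) \<in> parcs G then v $ j else 0))"
    by (rule sum.cong) auto
  finally show ?thesis .
qed

text \<open>Eigenvalues in terms of functions on the vertex set.\<close>

lemma eigenvalue_adjacency_mat_iff:
  assumes xs: "distinct xs" "set xs = V"
  shows "eigenvalue (adjacency_mat xs G) \<mu> \<longleftrightarrow>
    (\<exists>f. (\<exists>u\<in>V. f u \<noteq> 0) \<and>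
         (\<forall>u\<in>V. (\<Sum>w\<in>V. if (u, w) \<in> parcs G then f w else 0) = \<mu> * f u))"
    (is "?L \<longleftrightarrow> ?R")
proof -
  define m where "m = length xs"
  have bij: "bij_betw ((!) xs) {..<m} V"
    using xs by (auto simp: m_def intro: bij_betw_nth)
  have V: "V = (!) xs ` {..<m}" using bij by (simp add: bij_betw_def)
  have sum_eq: "(\<Sum>w\<in>V. h w) = (\<Sum>j<m. h (xs ! j))" for h :: "'a \<Rightarrow> real"
    using sum.reindex_bij_betw[OF bij, of h] by simp
  have dim: "dim_row (adjacency_mat xs G) = m" by (simp add: adjacency_mat_def m_def)
  show ?thesis
  proof
    assume ?L
    then obtain v where v: "v \<in> carrier_vec m" "v \<noteq> 0\<^sub>v m" "adjacency_mat xs G *\<^sub>v v = \<mu> \<cdot>\<^sub>v v"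
      by (auto simp: eigenvalue_def eigenvector_def dim)
    define f where "f u = v $ the_inv_into {..<m} ((!) xs) u" for u
    have f: "f (xs ! i) = v $ i" if "i < m" for i
      using that bij by (simp add: f_def the_inv_into_f_f bij_betw_def)
    obtain i where "i < m" "v $ i \<noteq> 0"
      using v(1,2) by (metis carrier_vecD eq_vecI index_zero_vec(1,2))
    then have "\<exists>u\<in>V. f u \<noteq> 0" using f V by auto
    moreover have "(\<Sum>w\<in>V. if (u, w) \<in> parcs G then f w else 0) = \<mu> * f u" if "u \<in> V" for u
    proof -
      obtain i where i: "i < m" "u = xs ! i" using \<open>u \<in> V\<close> V by auto
      have "(\<Sum>w\<in>V. if (u, w) \<in> parcs G then f w else 0) = (adjacency_mat xs G *\<^sub>v v) $ i"
        unfolding sum_eq using i v(1)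
        by (subst adjacency_mat_mult_index) (auto simp: f simp flip: m_def intro!: sum.cong)
      also have "\<dots> = \<mu> * f u" using i v by (simp add: f)
      finally show ?thesis .
    qed
    ultimately show ?R by blast
  next
    assume ?R
    then obtain f where f: "\<exists>u\<in>V. f u \<noteq> 0"
      "\<And>u. u \<in> V \<Longrightarrow> (\<Sum>w\<in>V. if (u, w) \<in> parcs G then f w else 0) = \<mu> * f u"
      by blast
    define v where "v = Matrix.vec m (\<lambda>i. f (xs ! i))"
    have v: "v \<in> carrier_vec m" by (simp add: v_def)
    obtain i where "i < m" "f (xs ! i) \<noteq> 0" using f(1) V by auto
    then have "v $ i \<noteq> 0\<^sub>v m $ i" by (simp add: v_def)
    then have "v \<noteq> 0\<^sub>v m" by auto
    moreover have "adjacency_mat xs G *\<^sub>v v = \<mu> \<cdot>\<^sub>v v"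
    proof (rule eq_vecI)
      fix i assume "i < dim_vec (\<mu> \<cdot>\<^sub>v v)"
      then have i: "i < m" by (simp add: v_def)
      have "(adjacency_mat xs G *\<^sub>v v) $ i =
          (\<Sum>j<m. if (xs ! i, xs ! j) \<in> parcs G then f (xs ! j) else 0)"
        using i v by (subst adjacency_mat_mult_index)
          (auto simp: v_def simp flip: m_def intro!: sum.cong)
      also have "\<dots> = \<mu> * f (xs ! i)"
        using f(2)[of "xs ! i", unfolded sum_eq] i bij by (auto simp: bij_betw_def)
      finally show "(adjacency_mat xs G *\<^sub>v v) $ i = (\<mu> \<cdot>\<^sub>v v) $ i" using i by (simp add: v_def)
    qed (simp add: dim v_def)
    ultimately show ?L using v by (auto simp: eigenvalue_def eigenvector_def dim)
  qed
qed

lemma graph_spectral_radius_eq: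
  assumes "distinct xs" "set xs = pverts G"
  shows "graph_spectral_radius G = Max (spectrum (adjacency_mat xs G))"
proof -
  let ?ys = "SOME xs. distinct xs \<and> set xs = pverts G"
  have ys: "distinct ?ys" "set ?ys = pverts G"
    using someI[of "\<lambda>xs. distinct xs \<and> set xs = pverts G" xs] assms by auto
  have "spectrum (adjacency_mat ?ys G) = spectrum (adjacency_mat xs G)"
    by (auto simp: spectrum_def eigenvalue_adjacency_mat_iff[OF ys]
        eigenvalue_adjacency_mat_iff[OF assms])
  then show ?thesis by (simp add: graph_spectral_radius_def)
qed

lemma adjacency_spectrum_finite: "finite (spectrum (adjacency_mat xs G))"
  by (rule card_finite_spectrum(1)[OF adjacency_mat_carrier])

lemma adjacency_spectrum_nonempty:
  assumes "pair_graph G" "pverts G \<noteq> {}" "distinct xs" "set xs = pverts G"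
  shows "spectrum (adjacency_mat xs G) \<noteq> {}"
proof -
  define m where "m = length xs"
  define a where "a i j = (if (xs ! i, xs ! j) \<in> parcs G then 1 else 0 :: real)" for i j
  define A where "A = adjacency_mat xs G"
  define B where "B = map_mat complex_of_real A"
  have a_sym: "a i j = a j i" for i j
    using pair_graph_explicit(3)[OF assms(1)] by (auto simp: a_def sym_def)
  have B: "B \<in> carrier_mat m m" by (simp add: A_def B_def m_def)
  have A: "A \<in> carrier_mat m m" by (simp add: A_def m_def)
  have "m > 0" using assms by (auto simp: m_def)
  then obtain z where "eigenvalue B z"
    using spectrum_non_empty[OF B] by (auto simp: spectrum_def)
  then obtain v where v: "v \<in> carrier_vec m" "v \<noteq> 0\<^sub>v m" "B *\<^sub>v v = z \<cdot>\<^sub>v v"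
    using B by (auto simp: eigenvalue_def eigenvector_def)
  have row: "(\<Sum>j<m. of_real (a i j) * v $ j) = z * v $ i" if "i < m" for i
  proof -
    have "(B *\<^sub>v v) $ i = (\<Sum>j<m. of_real (a i j) * v $ j)"
      using that v(1) by (auto simp: B_def A_def adjacency_mat_def scalar_prod_def a_def
          atLeast0LessThan simp flip: m_def intro!: sum.cong)
    then show ?thesis using that v by simp
  qed
  have "z \<in> \<real>"
  proof -
    let ?q = "\<Sum>i<m. \<Sum>j<m. of_real (a i j) * cnj (v $ i) * v $ j"
    let ?s = "\<Sum>i<m. (cmod (v $ i))\<^sup>2"
    have q: "?q = z * of_real ?s"
    proof -
      have "?q = (\<Sum>i<m. cnj (v $ i) * (\<Sum>j<m. of_real (a i j) * v $ j))"
        by (simp add: sum_distrib_left mult_ac)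
      also have "\<dots> = (\<Sum>i<m. cnj (v $ i) * (z * v $ i))"
        by (rule sum.cong) (auto simp: row)
      also have "\<dots> = (\<Sum>i<m. z * of_real ((cmod (v $ i))\<^sup>2))"
        by (rule sum.cong) (simp_all only: complex_norm_square mult_ac)
      finally show ?thesis by (simp add: sum_distrib_left)
    qed
    have "cnj ?q = (\<Sum>i<m. \<Sum>j<m. of_real (a i j) * v $ i * cnj (v $ j))"
      by simp
    also have "\<dots> = (\<Sum>j<m. \<Sum>i<m. of_real (a i j) * v $ i * cnj (v $ j))"
      by (rule sum.swap)
    also have "\<dots> = ?q"
      by (intro sum.cong refl) (simp add: a_sym mult_ac)
    finally have "cnj ?q = ?q" .
    then have "cnj z * of_real ?s = z * of_real ?s" unfolding q by simp
    moreover have "?s \<noteq> 0"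
    proof -
      obtain i where "i < m" "v $ i \<noteq> 0"
        using v(1,2) by (metis carrier_vecD eq_vecI index_zero_vec(1,2))
      then have "?s > 0" by (intro sum_pos2[of _ i]) auto
      then show ?thesis by simp
    qed
    ultimately have "cnj z = z" by (metis mult_right_cancel of_real_eq_0_iff)
    then show ?thesis by (simp add: Reals_cnj_iff)
  qed
  then obtain r where r: "z = of_real r" by (auto elim: Reals_cases)
  have "poly (char_poly B) z = 0"
    using \<open>eigenvalue B z\<close> eigenvalue_root_char_poly[OF B] by simp
  moreover have "char_poly B = map_poly of_real (char_poly A)"
    unfolding B_def by (rule of_real_hom.char_poly_hom[OF A])
  ultimately have "poly (char_poly A) r = 0" by (simp add: r)
  then show ?thesis
    using eigenvalue_root_char_poly[OF A] by (auto simp: spectrum_def A_def)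
qed

end

theory Submission
  imports Defs
begin

text \<open>Both extremal graphs arise from a clique \<open>C\<close> on \<open>n - k\<close> vertices by adding a set \<open>X\<close> of \<open>k\<close>
  vertices of degree \<open>k\<close> that meet \<open>C\<close> only in a set \<open>Y\<close> of \<open>h\<close> vertices (\<open>h = k\<close> for \<open>M\<^sub>k(n)\<close>,
  \<open>h = 1\<close> for \<open>L\<^sub>k(n)\<close>). The degree bound forces \<open>G\<close> to keep all edges at \<open>X\<close>, so a proper subgraph
  lacks an edge \<open>uv\<close> inside \<open>C\<close>. Let \<open>x \<ge> 0\<close> be the absolute value of an eigenvector for an
  eigenvalue at least \<open>\<mu> = n - k - 1\<close>, and let \<open>S\<close>, \<open>W\<close>, \<open>T\<close> be its weights on \<open>C\<close>, \<open>X\<close>, \<open>Y\<close>. Each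
  \<open>i \<in> C\<close> satisfies \<open>(\<mu> + 1) x\<^sub>i \<le> S + [i \<in> Y] W\<close>, with \<open>x\<^sub>v\<close> subtracted for \<open>i = u\<close> and vice
  versa. Summing over \<open>C\<close> gives \<open>x\<^sub>u + x\<^sub>v \<le> h W\<close>, summing over \<open>C - {u, v}\<close> shows that
  \<open>x\<^sub>u + x\<^sub>v\<close> is at least about \<open>2 S / (\<mu> + 1)\<close>, so \<open>2 S \<le> (\<mu> + 2) h W\<close>. Conversely \<open>W\<close> is small
  compared with \<open>S\<close>: \<open>(\<mu> - k + h) W \<le> k T\<close> and \<open>(\<mu> + 1) T \<le> h (S + W)\<close>. For
  \<open>2 \<mu> \<ge> k\<^sup>3 + 6\<close> these bounds contradict each other.\<close>

section \<open>Weights of a subeigenvector when a clique edge is missing\<close>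

text \<open>Eliminating \<open>T\<close> and then \<open>S\<close> leaves
  \<open>c * W \<le> 0\<close>, and the bound on \<open>m\<close> makes the coefficient
  \<open>c\<close> positive.\<close>

lemma weight_bounds_imp_nonpos:
  fixes m k h S T W :: real
  assumes h: "1 \<le> h" "h \<le> k" and m: "k ^ 3 + 6 \<le> 2 * m"
    and S: "2 * S \<le> (m + 2) * h * W" and T: "(m + 1) * T \<le> h * (S + W)"
    and W: "(m - (k - h)) * W \<le> k * T"
  shows "W \<le> 0"
proof -
  have k2: "k\<^sup>2 \<le> k ^ 3" using h by (intro power_increasing) auto
  have k0: "0 \<le> k ^ 3" using h by simp
  have m0: "m \<ge> 3" using m k0 by linarith
  have "2 * (m - (k - h)) * (m + 1) * W = 2 * (m + 1) * ((m - (k - h)) * W)"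
    by (simp add: algebra_simps)
  also have "\<dots> \<le> 2 * (m + 1) * (k * T)" using W m0 by (intro mult_left_mono) auto
  also have "\<dots> = 2 * k * ((m + 1) * T)" by (simp add: algebra_simps)
  also have "\<dots> \<le> 2 * k * (h * (S + W))" using T h by (intro mult_left_mono) auto
  also have "\<dots> = k * h * (2 * S + 2 * W)" by (simp add: algebra_simps)
  also have "\<dots> \<le> k * h * ((m + 2) * h * W + 2 * W)" using S h by (intro mult_left_mono) auto
  finally have main: "(2 * (m - (k - h)) * (m + 1) - k * h * ((m + 2) * h + 2)) * W \<le> 0"
    by (simp add: algebra_simps)
  \<comment> \<open>As \<open>(k - h) * k * (k + h) = k ^ 3 - k * h\<^sup>2\<close>, the loss
    \<open>2 * (k - h)\<close> and the term \<open>k * h\<^sup>2\<close> together fit into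
    \<open>k ^ 3 \<le> 2 * m - 6\<close>.\<close>
  have kk: "2 \<le> k * (k + h)" using mult_mono[of 1 k 2 "k + h"] h by simp
  have "(k - h) * 2 \<le> (k - h) * (k * (k + h))" using kk h by (intro mult_left_mono) auto
  then have "(k - h) * 2 * (m + 2) \<le> (k - h) * (k * (k + h)) * (m + 2)"
    using m0 by (intro mult_right_mono) auto
  moreover have "k * h \<le> 2 * m - 6"
  proof -
    have "k * h \<le> k\<^sup>2" unfolding power2_eq_square using h by (intro mult_left_mono) auto
    then show ?thesis using k2 m by linarith
  qed
  moreover have "k ^ 3 * (m + 2) \<le> (2 * m - 6) * (m + 2)"
    using m m0 by (intro mult_right_mono) auto
  ultimately have "0 < 2 * (m - (k - h)) * (m + 1) - k * h * ((m + 2) * h + 2)"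
    using m0 h by (simp add: algebra_simps power3_eq_cube)
  then show ?thesis using main by (simp add: mult_le_0_iff)
qed

text \<open>The inequality \<open>sub\<close> is what the absolute value of an eigenvector
  satisfies, whatever its signs. With \<open>deg\<close>, a vertex of \<open>X\<close> has at most
  \<open>k - h\<close> neighbours in \<open>X\<close> and \<open>h\<close> in \<open>Y\<close>, so
  at most \<open>k\<close> in all.\<close>

lemma subeigenvector_eq_0:
  fixes x :: "'a \<Rightarrow> real" and m :: real
  assumes fin: "finite C" "finite X" and disj: "C \<inter> X = {}" and Y: "Y \<subseteq> C" "card Y = h"
    and k: "card X = k" and h: "1 \<le> h" "h \<le> k"
    and C: "real (card C) = m + 1" and m: "real k ^ 3 + 6 \<le> 2 * m"
    and E: "E \<subseteq> (C \<union> X) \<times> (C \<union> X)" "sym E" "irrefl E"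
    and attach: "\<And>a b. (a, b) \<in> E \<Longrightarrow> a \<in> X \<Longrightarrow> b \<in> C \<Longrightarrow> b \<in> Y"
    and deg: "\<And>a. a \<in> X \<Longrightarrow> card {b \<in> X. (a, b) \<in> E} \<le> k - h"
    and uv: "u \<in> C" "v \<in> C" "u \<noteq> v" "(u, v) \<notin> E"
    and x0: "\<And>a. 0 \<le> x a"
    and sub: "\<And>a. a \<in> C \<union> X \<Longrightarrow> m * x a \<le> sum x (E `` {a})"
    and a: "a \<in> C \<union> X"
  shows "x a = 0"
proof -
  define S where "S = sum x C"
  define W where "W = sum x X"
  define T where "T = sum x Y"
  have W0: "0 \<le> W" and S0: "0 \<le> S"
    by (simp_all add: W_def S_def sum_nonneg x0)
  have finY: "finite Y" using Y fin finite_subset by blast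
  have sum_ind: "(\<Sum>i\<in>B. if i \<in> Y then W else 0) = card (B \<inter> Y) * W" if "finite B" for B
    using that by (simp add: sum.If_cases Int_def)
  have vu: "(v, u) \<notin> E" using uv E by (auto dest: symD)
  have nb: "(m + 1) * x i \<le> S + (if i \<in> Y then W else 0)
      - ((if i = u then x v else 0) + (if i = v then x u else 0))" if i: "i \<in> C" for i
  proof -
    \<comment> \<open>\<open>R\<close> holds the clique vertex that \<open>i\<close> misses because
      of \<open>uv\<close>, and \<open>X'\<close> the part of \<open>X\<close> within its reach.
      Removing \<open>i\<close> itself from \<open>C\<close> turns \<open>m\<close> into
      \<open>m + 1\<close>.\<close>
    define R where "R = (if i = u then {v} else if i = v then {u} else {})"
    define X' where "X' = (if i \<in> Y then X else {})"
    have "E `` {i} \<subseteq> (C - insert i R) \<union> X'"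
    proof
      fix b assume "b \<in> E `` {i}"
      then have b: "(i, b) \<in> E" by simp
      then have "b \<in> C \<union> X" "b \<noteq> i" using E(1,3) by (auto simp: irrefl_def)
      moreover have "b \<notin> R" using b uv(4) vu by (auto simp: R_def)
      moreover have "i \<in> Y" if "b \<in> X" using attach[OF symD[OF E(2) b] that i] .
      ultimately show "b \<in> (C - insert i R) \<union> X'" by (auto simp: X'_def)
    qed
    then have "sum x (E `` {i}) \<le> sum x ((C - insert i R) \<union> X')"
      using fin by (intro sum_mono2) (auto simp: X'_def x0)
    also have "\<dots> = sum x (C - insert i R) + sum x X'"
      using fin disj by (intro sum.union_disjoint) (auto simp: X'_def)
    also have "sum x (C - insert i R) = S - sum x (insert i R)"
      unfolding S_def using fin i uv by (intro sum_diff) (auto simp: R_def)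
    also have "sum x (insert i R) = x i + ((if i = u then x v else 0) + (if i = v then x u else 0))"
      using uv by (auto simp: R_def)
    finally show ?thesis
      using sub[of i] i by (auto simp: X'_def W_def algebra_simps)
  qed
  \<comment> \<open>Since \<open>C\<close> has \<open>m + 1\<close> vertices,
    \<open>(m + 1) * S\<close> cancels from both sides.\<close>
  have "(m + 1) * S \<le> (\<Sum>i\<in>C. S + (if i \<in> Y then W else 0)
      - ((if i = u then x v else 0) + (if i = v then x u else 0)))"
    unfolding S_def sum_distrib_left by (intro sum_mono) (use nb S_def in auto)
  also have "\<dots> = (m + 1) * S + h * W - (x u + x v)"
    using fin uv Y C by (simp add: sum_subtractf sum.distrib sum_ind Int_absorb1)
  finally have upper: "x u + x v \<le> h * W" by simp
  have card_uv: "real (card (C - {u, v})) = m - 1"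
  proof -
    have "card {u, v} \<le> card C" using fin uv by (intro card_mono) auto
    then show ?thesis using C fin uv by (subst card_Diff_subset) (auto simp: of_nat_diff)
  qed
  \<comment> \<open>Away from \<open>u\<close> and \<open>v\<close> there are no corrections and
    \<open>S\<close> is counted only \<open>m - 1\<close> times, so a surplus of
    \<open>2 * S\<close> remains on the left.\<close>
  have "(m + 1) * (S - (x u + x v)) = (m + 1) * sum x (C - {u, v})"
    using fin uv by (subst sum_diff) (auto simp: S_def)
  also have "\<dots> \<le> (\<Sum>i\<in>C - {u, v}. S + (if i \<in> Y then W else 0))"
    unfolding sum_distrib_left
  proof (rule sum_mono)
    fix i assume "i \<in> C - {u, v}"
    then show "(m + 1) * x i \<le> S + (if i \<in> Y then W else 0)" using nb[of i] by auto
  qed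
  also have "\<dots> = (m - 1) * S + card ((C - {u, v}) \<inter> Y) * W"
    using fin card_uv by (simp add: sum.distrib sum_ind)
  also have "\<dots> \<le> (m - 1) * S + h * W"
    using Y finY W0 by (auto intro!: mult_right_mono card_mono)
  finally have "2 * S \<le> (m + 1) * (x u + x v) + h * W" by (simp add: algebra_simps)
  also have "\<dots> \<le> (m + 1) * (h * W) + h * W"
    using upper C by (intro add_right_mono mult_left_mono) auto
  finally have S_le: "2 * S \<le> (m + 2) * h * W" by (simp add: algebra_simps)
  have "(m + 1) * T \<le> (\<Sum>i\<in>Y. S + W)"
    unfolding T_def sum_distrib_left
  proof (rule sum_mono)
    fix i assume "i \<in> Y"
    then show "(m + 1) * x i \<le> S + W"
      using nb[of i] Y x0[of u] x0[of v] by (auto split: if_splits)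
  qed
  then have T_le: "(m + 1) * T \<le> h * (S + W)" using Y by simp
  have "m * W \<le> (\<Sum>b\<in>X. T + (\<Sum>a\<in>X. if (b, a) \<in> E then x a else 0))"
    unfolding W_def sum_distrib_left
  proof (rule sum_mono)
    fix b assume b: "b \<in> X"
    have "E `` {b} \<subseteq> Y \<union> {a \<in> X. (b, a) \<in> E}" using E b attach by auto
    then have "sum x (E `` {b}) \<le> sum x (Y \<union> {a \<in> X. (b, a) \<in> E})"
      using finY fin by (intro sum_mono2) (auto simp: x0)
    also have "\<dots> = T + sum x {a \<in> X. (b, a) \<in> E}"
      unfolding T_def using finY fin disj Y by (intro sum.union_disjoint) auto
    also have "sum x {a \<in> X. (b, a) \<in> E} = (\<Sum>a\<in>X. if (b, a) \<in> E then x a else 0)"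
      using fin by (simp add: sum.inter_filter)
    finally show "m * x b \<le> T + (\<Sum>a\<in>X. if (b, a) \<in> E then x a else 0)"
      using sub[of b] b by simp
  qed
  \<comment> \<open>After the swap, \<open>x a\<close> is counted once for each neighbour of
    \<open>a\<close> in \<open>X\<close>, hence at most \<open>k - h\<close> times.\<close>
  also have "\<dots> = k * T + (\<Sum>a\<in>X. \<Sum>b\<in>X. if (b, a) \<in> E then x a else 0)"
    using k by (simp add: sum.distrib) (rule sum.swap)
  also have "(\<Sum>a\<in>X. \<Sum>b\<in>X. if (b, a) \<in> E then x a else 0) \<le> (\<Sum>a\<in>X. (k - h) * x a)"
  proof (rule sum_mono)
    fix a assume a: "a \<in> X"
    have "(\<Sum>b\<in>X. if (b, a) \<in> E then x a else 0) = card {b \<in> X. (b, a) \<in> E} * x a"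
      using fin by (simp flip: sum.inter_filter)
    also have "{b \<in> X. (b, a) \<in> E} = {b \<in> X. (a, b) \<in> E}" using E(2) by (auto dest: symD)
    finally show "(\<Sum>b\<in>X. if (b, a) \<in> E then x a else 0) \<le> (k - h) * x a"
      using deg[OF a] x0[of a] by (simp add: mult_right_mono)
  qed
  also have "\<dots> = (real k - real h) * W" using h by (simp add: W_def sum_distrib_left of_nat_diff)
  finally have W_le: "(m - (real k - real h)) * W \<le> k * T" by (simp add: algebra_simps)
  have "W \<le> 0"
    by (rule weight_bounds_imp_nonpos[OF _ _ m S_le T_le W_le]) (use h in auto)
  then have "W = 0" using W0 by simp
  then have "S = 0" using S_le S0 by simp
  then show ?thesis
    using \<open>W = 0\<close> a fin x0 by (auto simp: S_def W_def sum_nonneg_eq_0_iff)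
qed

section \<open>Passage from graphs to weights\<close>

text \<open>The triangle inequality turns the eigenvalue equation into this inequality for absolute
  values, which gives nonnegativity without Perron-Frobenius theory.\<close>

lemma spectral_radius_subeigenvector:
  assumes G: "pair_graph G" and ne: "pverts G \<noteq> {}"
  obtains x :: "'a \<Rightarrow> real" where "\<And>u. 0 \<le> x u" "\<exists>u\<in>pverts G. x u \<noteq> 0"
    "\<And>u. u \<in> pverts G \<Longrightarrow> graph_spectral_radius G * x u \<le> sum x (parcs G `` {u})"
proof -
  note fin = pair_graph_explicit(1)[OF G] and arcs = pair_graph_explicit(2)[OF G]
  obtain xs where xs: "distinct xs" "set xs = pverts G" using finite_distinct_list[OF fin] by blast
  have "graph_spectral_radius G \<in> spectrum (adjacency_mat xs G)"
    unfolding graph_spectral_radius_eq[OF xs]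
    by (intro Max_in adjacency_spectrum_finite adjacency_spectrum_nonempty[OF G ne xs])
  then have "eigenvalue (adjacency_mat xs G) (graph_spectral_radius G)"
    by (simp add: spectrum_def)
  then obtain f where f: "\<exists>u\<in>pverts G. f u \<noteq> 0" "\<And>u. u \<in> pverts G \<Longrightarrow>
      (\<Sum>w\<in>pverts G. if (u, w) \<in> parcs G then f w else 0) = graph_spectral_radius G * f u"
    unfolding eigenvalue_adjacency_mat_iff[OF xs] by blast
  show ?thesis
  proof
    show "0 \<le> \<bar>f u\<bar>" for u by simp
    show "\<exists>u\<in>pverts G. \<bar>f u\<bar> \<noteq> 0" using f(1) by simp
    fix u assume u: "u \<in> pverts G"
    have "parcs G `` {u} = {w \<in> pverts G. (u, w) \<in> parcs G}" using arcs by auto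
    then have "sum f (parcs G `` {u}) = graph_spectral_radius G * f u"
      using f(2)[OF u] fin by (simp add: sum.inter_filter)
    then have "\<bar>graph_spectral_radius G * f u\<bar> \<le> (\<Sum>w\<in>parcs G `` {u}. \<bar>f w\<bar>)"
      using sum_abs[of f "parcs G `` {u}"] by simp
    moreover have "graph_spectral_radius G * \<bar>f u\<bar> \<le> \<bar>graph_spectral_radius G * f u\<bar>"
      by (simp add: abs_mult mult_right_mono)
    ultimately show "graph_spectral_radius G * \<bar>f u\<bar> \<le> (\<Sum>w\<in>parcs G `` {u}. \<bar>f w\<bar>)" by simp
  qed
qed

text \<open>Tail and head in a subgraph of \<open>with_proj H\<close> are the projections, so the
  vertex part of an isomorphism determines its action on arcs.\<close>

lemma subgraph_upto_isoE:
  fixes G :: "'a pair_pre_digraph" and H :: "'b pair_pre_digraph"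
  assumes "subgraph_upto_iso G H"
  obtains \<phi> where "inj_on \<phi> (pverts G)" "\<phi> ` pverts G \<subseteq> pverts H"
    "map_prod \<phi> \<phi> ` parcs G \<subseteq> parcs H"
    "\<phi> ` pverts G = pverts H \<Longrightarrow> map_prod \<phi> \<phi> ` parcs G = parcs H \<Longrightarrow> digraph_iso G H"
proof -
  obtain H' where H': "subgraph H' (with_proj H)" "digraph_iso (with_proj G) H'"
    using assms by (auto simp: subgraph_upto_iso_def)
  obtain f where f: "pre_digraph.digraph_isomorphism (with_proj G) f" "H' = app_iso f (with_proj G)"
    using H'(2) by (auto simp: digraph_iso_def)
  define \<phi> where "\<phi> = iso_verts f"
  have proj: "tail H' = fst" "head H' = snd"
    using H'(1) by (auto simp: subgraph_def compatible_def)
  have "iso_arcs f e = map_prod \<phi> \<phi> e" if "e \<in> parcs G" for e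
    using that f(1) proj unfolding pre_digraph.digraph_isomorphism_def f(2)
    by (auto simp: \<phi>_def prod_eq_iff)
  then have arcs: "arcs H' = map_prod \<phi> \<phi> ` parcs G" by (auto simp: f(2))
  have verts: "verts H' = \<phi> ` pverts G" by (simp add: f(2) \<phi>_def)
  show thesis
  proof
    show "inj_on \<phi> (pverts G)"
      using f(1) by (simp add: pre_digraph.digraph_isomorphism_def \<phi>_def)
    show "\<phi> ` pverts G \<subseteq> pverts H" "map_prod \<phi> \<phi> ` parcs G \<subseteq> parcs H"
      using H'(1) by (auto simp: subgraph_def verts arcs)
    assume "\<phi> ` pverts G = pverts H" "map_prod \<phi> \<phi> ` parcs G = parcs H"
    then have "H' = with_proj H"
      by (intro pre_digraph.equality) (auto simp: verts arcs proj)
    then show "digraph_iso G H" using H'(2) by simp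
  qed
qed

lemma min_degree_le_card_neighbours:
  assumes "pair_graph G" "u \<in> pverts G"
  shows "min_degree G \<le> card (parcs G `` {u})"
proof -
  have "out_arcs (with_proj G) u = Pair u ` (parcs G `` {u})"
    by (auto simp: out_arcs_def)
  then have "out_degree (with_proj G) u = card (parcs G `` {u})"
    by (simp add: out_degree_def card_image inj_on_def)
  then show ?thesis
    using Min_le[OF finite_imageI imageI, OF pair_graph_explicit(1)[OF assms(1)] assms(2),
        of "out_degree G"]
    by (simp add: min_degree_def)
qed

text \<open>Common form of both cases: vertices of \<open>X\<close> have degree at most
  \<open>h + (k - h) = k\<close> in \<open>H\<close>, so the minimum degree keeps every edge at
  \<open>X\<close>, and a missing edge avoids \<open>X\<close>.\<close>

lemma spectral_radius_less_or_iso: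
  fixes G :: "'a pair_pre_digraph" and H :: "'b pair_pre_digraph"
  assumes G: "pair_graph G" "card (pverts G) = n" "k \<le> min_degree G"
    and H: "pair_graph H" "card (pverts H) = n"
    and sub: "subgraph_upto_iso G H"
    and X: "X \<subseteq> pverts H" "card X = k"
    and Y: "Y \<subseteq> pverts H - X" "card Y = h" and h: "1 \<le> h" "h \<le> k"
    and attach: "\<And>a b. (a, b) \<in> parcs H \<Longrightarrow> a \<in> X \<Longrightarrow> b \<notin> X \<Longrightarrow> b \<in> Y"
    and deg: "\<And>a. a \<in> X \<Longrightarrow> card {b \<in> X. (a, b) \<in> parcs H} \<le> k - h"
    and n: "real k ^ 3 / 2 + real k + 4 \<le> real n"
  shows "graph_spectral_radius G < real n - real k - 1 \<or> digraph_iso G H"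
proof (rule ccontr)
  assume contra: "\<not> ?thesis"
  note HG = pair_graph_explicit[OF H(1)] and GG = pair_graph_explicit[OF G(1)]
  obtain \<phi> where inj: "inj_on \<phi> (pverts G)" and im: "\<phi> ` pverts G \<subseteq> pverts H"
    and arcs: "map_prod \<phi> \<phi> ` parcs G \<subseteq> parcs H"
    and iso: "\<phi> ` pverts G = pverts H \<Longrightarrow> map_prod \<phi> \<phi> ` parcs G = parcs H \<Longrightarrow> digraph_iso G H"
    using subgraph_upto_isoE[OF sub] by blast
  define E where "E = map_prod \<phi> \<phi> ` parcs G"
  have onto: "\<phi> ` pverts G = pverts H"
    using im HG(1) inj G(2) H(2) by (intro card_subset_eq) (auto simp: card_image)
  have finX: "finite X" and finY: "finite Y"
    using X(1) Y(1) HG(1) by (auto intro: finite_subset)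
  have EH: "E \<subseteq> parcs H" using arcs by (simp add: E_def)
  have nbE: "E `` {\<phi> w} = \<phi> ` (parcs G `` {w})" if "w \<in> pverts G" for w
  proof
    show "E `` {\<phi> w} \<subseteq> \<phi> ` (parcs G `` {w})"
    proof
      fix b assume "b \<in> E `` {\<phi> w}"
      then obtain p q where pq: "(p, q) \<in> parcs G" "\<phi> p = \<phi> w" "b = \<phi> q" by (auto simp: E_def)
      then have "p = w" using inj GG(2) that by (auto dest: inj_onD)
      then show "b \<in> \<phi> ` (parcs G `` {w})" using pq by auto
    qed
  qed (auto simp: E_def)
  have inj_nb: "inj_on \<phi> (parcs G `` {w})" for w
    using GG(2) by (intro inj_on_subset[OF inj]) auto
  have keep: "E `` {a} = parcs H `` {a}" if a: "a \<in> X" for a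
  proof (rule card_seteq)
    obtain w where w: "w \<in> pverts G" "a = \<phi> w" using a X(1) onto by auto
    have "parcs H `` {a} \<subseteq> Y \<union> {b \<in> X. (a, b) \<in> parcs H}" using attach a by auto
    then have "card (parcs H `` {a}) \<le> card (Y \<union> {b \<in> X. (a, b) \<in> parcs H})"
      using finX finY by (intro card_mono) auto
    also have "\<dots> \<le> h + (k - h)" using card_Un_le deg[OF a] Y(2) by (meson add_mono order.trans order.refl)
    also have "\<dots> \<le> card (parcs G `` {w})"
      using min_degree_le_card_neighbours[OF G(1) w(1)] G(3) h by simp
    also have "\<dots> = card (E `` {a})" using w inj_nb by (simp add: nbE card_image)
    finally show "card (parcs H `` {a}) \<le> card (E `` {a})" .
    show "finite (parcs H `` {a})"
      using HG(2) by (intro finite_subset[OF _ HG(1)]) auto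
  qed (use EH in auto)
  have symE: "sym E" using GG(3) by (fastforce simp: E_def sym_def)
  \<comment> \<open>The embedding is onto the vertices; were it also onto the arcs, it would be an
    isomorphism.\<close>
  have "\<not> parcs H \<subseteq> E" using contra iso onto EH by (auto simp: E_def)
  then obtain u v where uv: "(u, v) \<in> parcs H" "(u, v) \<notin> E" by auto
  have uX: "u \<notin> X" using keep[of u] uv by auto
  have vX: "v \<notin> X"
  proof
    assume "v \<in> X"
    then have "(v, u) \<in> E" using keep[of v] symD[OF HG(3) uv(1)] by auto
    then show False using symE uv(2) by (auto dest: symD)
  qed
  have "0 < real k ^ 3 / 2 + real k + 4" by (intro add_nonneg_pos add_nonneg_nonneg) auto
  then have "n > 0" using n by linarith
  then have "pverts G \<noteq> {}" using G(2) by auto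
  then obtain x :: "'a \<Rightarrow> real" where x: "\<And>w. 0 \<le> x w" "\<exists>w\<in>pverts G. x w \<noteq> 0"
    "\<And>w. w \<in> pverts G \<Longrightarrow> graph_spectral_radius G * x w \<le> sum x (parcs G `` {w})"
    using spectral_radius_subeigenvector[OF G(1)] by blast
  \<comment> \<open>Off the image of \<open>\<phi>\<close> the inverse is unspecified, but
    \<open>y\<close> stays nonnegative because \<open>x\<close> is so everywhere.\<close>
  define y where "y b = x (the_inv_into (pverts G) \<phi> b)" for b
  have y: "y (\<phi> w) = x w" if "w \<in> pverts G" for w
    using that inj by (simp add: y_def the_inv_into_f_f)
  have "y b = 0" if b: "b \<in> pverts H" for b
  proof (rule subeigenvector_eq_0[where C = "pverts H - X" and X = X and Y = Y and E = E
        and u = u and v = v and k = k and h = h and m = "real n - real k - 1"])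
    show "real (card (pverts H - X)) = real n - real k - 1 + 1"
      using X HG(1) H(2) finX card_mono[OF HG(1) X(1)] by (simp add: card_Diff_subset of_nat_diff)
    \<comment> \<open>Doubling the bound on \<open>n\<close> gives exactly this.\<close>
    show "real k ^ 3 + 6 \<le> 2 * (real n - real k - 1)" using n by simp
    show "E \<subseteq> (pverts H - X \<union> X) \<times> (pverts H - X \<union> X)" using EH HG(2) by auto
    show "irrefl E" using EH HG(4) by (auto simp: irrefl_def)
    show "b' \<in> Y" if "(a, b') \<in> E" "a \<in> X" "b' \<in> pverts H - X" for a b'
      using that attach EH by auto
    show "card {b \<in> X. (a, b) \<in> E} \<le> k - h" if "a \<in> X" for a
    proof -
      have "card {b \<in> X. (a, b) \<in> E} \<le> card {b \<in> X. (a, b) \<in> parcs H}"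
        using finX EH by (intro card_mono) auto
      then show ?thesis using deg[OF that] by simp
    qed
    show "u \<in> pverts H - X" "v \<in> pverts H - X" using uX vX uv HG(2) by auto
    show "u \<noteq> v" using uv HG(4) by (auto simp: irrefl_def)
    show "(real n - real k - 1) * y a \<le> sum y (E `` {a})" if "a \<in> pverts H - X \<union> X" for a
    proof -
      have "a \<in> \<phi> ` pverts G" unfolding onto using that X(1) by blast
      then obtain w where w: "w \<in> pverts G" "a = \<phi> w" by blast
      have "(real n - real k - 1) * x w \<le> graph_spectral_radius G * x w"
        using contra x(1) by (intro mult_right_mono) auto
      also have "\<dots> \<le> sum x (parcs G `` {w})" by (rule x(3)[OF w(1)])
      also have "\<dots> = sum y (\<phi> ` (parcs G `` {w}))"
        using GG(2) by (subst sum.reindex[OF inj_nb]) (auto simp: y intro!: sum.cong)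
      finally show ?thesis using w by (simp add: nbE y)
    qed
  qed (use finX HG(1) X Y h symE uv(2) b x(1) in \<open>auto simp: y_def\<close>)
  then show False using x(2) onto y by (metis imageI)
qed

theorem theorem6:
  fixes k n :: nat and G :: "'a pair_pre_digraph"
  assumes "k \<ge> 1"
    and "real n \<ge> real k ^ 3 / 2 + real k + 4"
    and "pair_graph G"
    and "card (pverts G) = n"
    and "min_degree G \<ge> k"
  shows "(subgraph_upto_iso G (M_graph k n) \<longrightarrow>
            graph_spectral_radius G < real n - real k - 1 \<or> digraph_iso G (M_graph k n)) \<and>
         (subgraph_upto_iso G (L_graph k n) \<longrightarrow>
            graph_spectral_radius G < real n - real k - 1 \<or> digraph_iso G (L_graph k n))"
proof -
  \<comment> \<open>In both graphs \<open>?X\<close> is the last summand; \<open>?Y k\<close> and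
    \<open>?Y 1\<close> are the dominating cliques of \<open>M_graph\<close> and
    \<open>L_graph\<close>.\<close>
  let ?X = "Inr ` Inr ` {..<k} :: (nat + (nat + nat)) set"
  let ?Y = "\<lambda>h. Inl ` {..<h} :: (nat + (nat + nat)) set"
  \<comment> \<open>The product expands to \<open>k ^ 3 - 3 * k + 2\<close>; the resulting
    \<open>2 * k + 1 \<le> n\<close> ensures that both graphs have order \<open>n\<close>.\<close>
  have "0 \<le> (real k + 2) * (real k - 1)\<^sup>2" by simp
  then have "3 * real k \<le> real k ^ 3 + 2"
    by (simp add: algebra_simps power2_eq_square power3_eq_cube)
  then have "2 * k + 1 \<le> n" using assms(2) by linarith
  note card = card_L_graph[OF this] card_M_graph[OF this]
  have cardX: "card ?X = k" by (simp add: card_image)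
  have cardY: "card (?Y h) = h" for h by (simp add: card_image)
  show ?thesis
  proof (intro conjI impI)
    assume "subgraph_upto_iso G (M_graph k n)"
    then show "graph_spectral_radius G < real n - real k - 1 \<or> digraph_iso G (M_graph k n)"
    proof (rule spectral_radius_less_or_iso[where X = ?X and Y = "?Y k" and h = k,
          OF assms(3-5) pair_graph_M_graph card(2)])
      show "b \<in> ?Y k" if "(a, b) \<in> parcs (M_graph k n)" "a \<in> ?X" "b \<notin> ?X" for a b
        using that by (cases b rule: sum.exhaust; cases "projr b")
          (auto simp: M_graph_def complete_graph_def edgeless_graph_def)
      show "card {b \<in> ?X. (a, b) \<in> parcs (M_graph k n)} \<le> k - k" if "a \<in> ?X" for a
        using that by (auto simp: M_graph_def edgeless_graph_def)
    qed (use assms cardX cardY in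
        \<open>auto simp: M_graph_def complete_graph_def edgeless_graph_def\<close>)
  next
    assume "subgraph_upto_iso G (L_graph k n)"
    then show "graph_spectral_radius G < real n - real k - 1 \<or> digraph_iso G (L_graph k n)"
    proof (rule spectral_radius_less_or_iso[where X = ?X and Y = "?Y 1" and h = 1,
          OF assms(3-5) pair_graph_L_graph card(1)])
      show "b \<in> ?Y 1" if "(a, b) \<in> parcs (L_graph k n)" "a \<in> ?X" "b \<notin> ?X" for a b
        using that by (cases b rule: sum.exhaust; cases "projr b")
          (auto simp: L_graph_def complete_graph_def)
      show "card {b \<in> ?X. (a, b) \<in> parcs (L_graph k n)} \<le> k - 1" if "a \<in> ?X" for a
      proof -
        have "{b \<in> ?X. (a, b) \<in> parcs (L_graph k n)} \<subseteq> ?X - {a}"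
          by (auto simp: L_graph_def complete_graph_def)
        then have "card {b \<in> ?X. (a, b) \<in> parcs (L_graph k n)} \<le> card (?X - {a})"
          by (intro card_mono) auto
        then show ?thesis using that cardX by (simp add: card_Diff_singleton)
      qed
    qed (use assms cardX cardY in \<open>auto simp: L_graph_def complete_graph_def\<close>)
  qed
qed

end
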